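(* Let $\alpha$ be a real number with $\frac16\le\alpha<\frac{52-16\sqrt{3}}{121}$, and let $p=\frac{1-\sqrt{\alpha(3-2\alpha)}}{1-2\alpha}$. Then $$\frac{3}{1+2p^2}>(\sqrt{\alpha}+1)^2,$$ and there exists some $\beta>(\sqrt{\alpha}+1)^2$ such that $r(B_{\lceil\alpha n\rceil},B_n)\ge \beta n$ for all sufficiently large $n$.
   Context: For graphs $G$ and $H$, the Ramsey number $r(G,H)$ is the smallest positive integer $N$ such that any red/blue edge coloring of the complete graph $K_N$ contains either a red copy of $G$ or a blue copy of $H$ (as a not necessarily induced subgraph). The book $B_m$ is the graph consisting of $m$ triangles all sharing a common edge (so it has $m+2$ vertices). The paper omits ceiling signs, writing $B_{\alpha n}$ for $B_{\lceil\alpha n\rceil}$. *)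

theory Defs
  imports Complex_Main "HOL-Library.Ramsey"
begin

type_synonym 'a graph = "'a set \<times> 'a set set"

definition simple_graph :: "'a graph \<Rightarrow> bool" where
  "simple_graph G \<longleftrightarrow> snd G \<subseteq> [fst G]\<^bsup>2\<^esup>"

text \<open>Copies are not required to be induced.\<close>

definition has_copy :: "'b graph \<Rightarrow> 'a graph \<Rightarrow> bool" where
  "has_copy G H \<longleftrightarrow>
     (\<exists>f. inj_on f (fst H) \<and> f ` fst H \<subseteq> fst G \<and> (\<forall>e\<in>snd H. f ` e \<in> snd G))"

text \<open>A colouring of the edges of the complete graph on \<open>{..<N}\<close> is given by its set \<open>R\<close> of red
  edges; all other edges are blue.\<close>

definition ramsey_arrow :: "nat \<Rightarrow> 'a graph \<Rightarrow> 'b graph \<Rightarrow> bool" where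
  "ramsey_arrow N G H \<longleftrightarrow>
     (\<forall>R. R \<subseteq> [{..<N}]\<^bsup>2\<^esup> \<longrightarrow>
        has_copy ({..<N}, R) G \<or> has_copy ({..<N}, [{..<N}]\<^bsup>2\<^esup> - R) H)"

definition ramsey_number :: "'a graph \<Rightarrow> 'b graph \<Rightarrow> nat" where
  "ramsey_number G H = (LEAST N. N > 0 \<and> ramsey_arrow N G H)"

text \<open>The book with \<open>m\<close> pages; its spine is the edge \<open>{0, 1}\<close>.\<close>

definition book :: "nat \<Rightarrow> nat graph" where
  "book m = ({..<m + 2}, insert {0, 1} (\<Union>k\<in>{2..<m + 2}. {{0, k}, {1, k}}))"

lemma simple_graph_book: "simple_graph (book m)"
  unfolding simple_graph_def book_def by auto

lemma finite_book: "finite (fst (book m))"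
  by (simp add: book_def)

text \<open>The minimum defining \<open>ramsey_number\<close> is attained for all finite simple graphs.\<close>

lemma has_copy_complete:
  assumes G: "simple_graph G" "finite (fst G)" and K: "finite K" "card K = card (fst G)"
    and V: "K \<subseteq> V" "[K]\<^bsup>2\<^esup> \<subseteq> E"
  shows "has_copy (V, E) G"
proof -
  obtain f where f: "bij_betw f (fst G) K"
    using finite_same_card_bij[OF G(2) K(1)] K(2) by auto
  have "f ` e \<in> E" if "e \<in> snd G" for e
  proof -
    have e: "e \<subseteq> fst G" "finite e" "card e = 2"
      using that G(1) by (auto simp: simple_graph_def nsets_def)
    have "inj_on f e" using f e(1) by (meson bij_betw_imp_inj_on inj_on_subset)
    then have "f ` e \<in> [K]\<^bsup>2\<^esup>"
      using e bij_betw_imp_surj_on[OF f] by (auto simp: nsets_def card_image)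
    then show ?thesis using V by blast
  qed
  then show ?thesis
    using f V(1) unfolding has_copy_def by (intro exI[of _ f]) (simp add: bij_betw_def)
qed

lemma ramsey_number_exists:
  fixes G :: "'a graph" and H :: "'b graph"
  assumes G: "simple_graph G" "finite (fst G)" and H: "simple_graph H" "finite (fst H)"
  shows "\<exists>N>0. ramsey_arrow N G H"
proof -
  obtain r where r1: "r \<ge> 1"
    and r: "\<forall>(V :: nat set) E. finite V \<and> card V \<ge> r \<longrightarrow>
      (\<exists>K \<subseteq> V. card K = card (fst G) \<and> clique K E \<or> card K = card (fst H) \<and> indep K E)"
    using ramsey2[where ?'a = nat, of "card (fst G)" "card (fst H)"] by (elim exE conjE)
  have "has_copy ({..<r}, R) G \<or> has_copy ({..<r}, [{..<r}]\<^bsup>2\<^esup> - R) H" for R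
  proof -
    obtain K where K: "K \<subseteq> {..<r}"
      "card K = card (fst G) \<and> clique K R \<or> card K = card (fst H) \<and> indep K R"
      using r[rule_format, of "{..<r}" R, OF conjI] by fastforce
    have fin: "finite K" using finite_subset[OF K(1)] by simp
    from K(2) show ?thesis
    proof
      assume *: "card K = card (fst G) \<and> clique K R"
      then have "[K]\<^bsup>2\<^esup> \<subseteq> R" by (auto simp: nsets_2_eq clique_def)
      then show ?thesis using has_copy_complete[OF G fin _ K(1)] * by simp
    next
      assume *: "card K = card (fst H) \<and> indep K R"
      then have "[K]\<^bsup>2\<^esup> \<subseteq> [{..<r}]\<^bsup>2\<^esup> - R" using K(1) by (auto simp: nsets_2_eq indep_def)
      then show ?thesis using has_copy_complete[OF H fin _ K(1)] * by simp
    qed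
  qed
  then show ?thesis using r1 unfolding ramsey_arrow_def by (intro exI[of _ r]) simp
qed

end

theory Submission
  imports Defs "HOL-Probability.Probability" "HOL-Real_Asymp.Real_Asymp"
begin

text \<open>
  The lower bound comes from a random colouring of a complete graph on three classes of \<open>m\<close>
  vertices. Edges inside a class are blue; an edge between two classes is blue with probability
  \<open>p\<close>, independently of the others. Up to lower order terms, the numbers of common neighbours are
  then as follows: a blue edge inside a class has \<open>(1 + 2 p\<^sup>2) m\<close> common blue neighbours, a blue
  edge between two classes has \<open>(2 p + p\<^sup>2) m\<close>, which is no more because \<open>(1 - p)\<^sup>2 \<ge> 0\<close>, and a
  red edge, which runs between two classes, has \<open>(1 - p)\<^sup>2 m\<close> common red neighbours, all in the third
  class. The prescribed \<open>p\<close> is the root in \<open>(0, 1)\<close> of \<open>(1 - p)\<^sup>2 = \<alpha> (1 + 2 p\<^sup>2)\<close>, so the conditions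
  against both books become critical together, when \<open>(1 + 2 p\<^sup>2) m\<close> reaches \<open>n\<close>. Hence every \<open>\<beta>\<close> with
  \<open>\<beta> < 3 / (1 + 2 p\<^sup>2)\<close> is an asymptotic lower bound for the Ramsey number divided by \<open>n\<close>
  (lemmas \<open>quasirandom_tripartite_exists\<close> and \<open>tripartite_colouring_avoids_books\<close>). The
  deviations are controlled by Hoeffding's inequality and a union bound over \<open>O(m\<^sup>2)\<close> events.

  For the numerical inequality put \<open>t = sqrt (1 + 2 p\<^sup>2)\<close>. Then \<open>sqrt \<alpha> * t = 1 - p\<close>, and
  \<open>(sqrt \<alpha> + 1) t < sqrt 3\<close> becomes \<open>t < sqrt 3 - 1 + p\<close>, that is,
  \<open>(p - 1) (p - (2 sqrt 3 - 3)) < 0\<close>. As \<open>(1 - p)\<^sup>2 / (1 + 2 p\<^sup>2)\<close> decreases on \<open>[0, 1]\<close> and takes the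
  value \<open>(52 - 16 sqrt 3) / 121\<close> at \<open>2 sqrt 3 - 3\<close>, the upper bound on \<open>\<alpha>\<close> says precisely that
  \<open>p > 2 sqrt 3 - 3\<close>.
\<close>

section \<open>Concentration for disjoint blocks of independent coordinates\<close>

text \<open>
  Whether \<open>\<omega>\<close> is constantly \<open>b\<close> on a block depends only on the coordinates in that block, so for
  disjoint blocks these events are independent, each of probability \<open>pmf q b ^ k\<close>, and Hoeffding's
  inequality applies to their number. Blocks of one or two edges give degrees or codegrees.
\<close>

lemma many_constant_blocks_unlikely:
  fixes S :: "'i \<Rightarrow> 'e set" and q :: "'c pmf"
  assumes E: "finite E" and I: "finite I" "I \<noteq> {}"
    and S: "\<And>i. i \<in> I \<Longrightarrow> S i \<subseteq> E" "\<And>i. i \<in> I \<Longrightarrow> card (S i) = k" "disjoint_family_on S I"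
    and \<epsilon>: "\<epsilon> \<ge> 0"
  shows "measure_pmf.prob (Pi_pmf E d (\<lambda>_. q))
      {\<omega>. real (card {i \<in> I. \<forall>e\<in>S i. \<omega> e = b}) \<ge> (pmf q b ^ k + \<epsilon>) * card I}
    \<le> exp (- 2 * \<epsilon>\<^sup>2 * card I)"
proof -
  define P where "P = Pi_pmf E d (\<lambda>_. q)"
  define X :: "'i \<Rightarrow> ('e \<Rightarrow> 'c) \<Rightarrow> real" where
    "X i \<omega> = (\<Prod>e\<in>S i. if \<omega> e = b then 1 else 0)" for i \<omega>
  have finS: "finite (S i)" if "i \<in> I" for i
    using finite_subset[OF S(1)[OF that] E] .
  have X_eq: "X i \<omega> = (if \<forall>e\<in>S i. \<omega> e = b then 1 else 0)" if "i \<in> I" for i \<omega>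
    using finS[OF that] by (auto simp: X_def)
  \<comment> \<open>The product form of \<open>X i\<close> exhibits it as a measurable function of the restriction to \<open>S i\<close>.\<close>
  have "prob_space.indep_vars (measure_pmf P) (\<lambda>_. borel) X I"
  proof -
    have "prob_space.indep_vars (measure_pmf P) (\<lambda>i. PiM (S i) (\<lambda>_. count_space UNIV))
        (\<lambda>i \<omega>. restrict (\<lambda>e. \<omega> e) (S i)) I"
      unfolding P_def using S(1,3)
      by (rule prob_space.indep_vars_restrict
          [OF measure_pmf.prob_space_axioms indep_vars_Pi_pmf[OF E]])
    then have "prob_space.indep_vars (measure_pmf P) (\<lambda>_. borel)
        (\<lambda>i \<omega>. (\<lambda>\<eta>. \<Prod>e\<in>S i. if \<eta> e = b then 1 else 0 :: real) (restrict \<omega> (S i))) I"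
    proof (rule prob_space.indep_vars_compose2[OF measure_pmf.prob_space_axioms])
      fix i assume "i \<in> I"
      have "(\<lambda>\<eta>. (\<lambda>c. if c = b then 1 else 0 :: real) (\<eta> e))
          \<in> borel_measurable (PiM (S i) (\<lambda>_. count_space UNIV))" if "e \<in> S i" for e
        by (rule measurable_compose[OF measurable_component_singleton[OF that]]) simp
      then show "(\<lambda>\<eta>. \<Prod>e\<in>S i. if \<eta> e = b then 1 else 0 :: real)
          \<in> borel_measurable (PiM (S i) (\<lambda>_. count_space UNIV))"
        by (intro borel_measurable_prod) simp
    qed
    then show ?thesis
      by (simp add: X_def[abs_def])
  qed
  then interpret Hoeffding_ineq "measure_pmf P" I X "\<lambda>_. 0" "\<lambda>_. 1"
      "\<Sum>i\<in>I. measure_pmf.expectation P (X i)"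
    using I by unfold_locales (auto simp: X_eq)
  have "measure_pmf.expectation P (X i) = pmf q b ^ k" if i: "i \<in> I" for i
  proof -
    have "X i = indicator (Pi E (\<lambda>e. if e \<in> S i then {b} else UNIV))"
      using S(1)[OF i] by (auto simp: X_eq[OF i] indicator_def Pi_def fun_eq_iff split: if_splits)
    then have "measure_pmf.expectation P (X i)
        = measure_pmf.prob P (Pi E (\<lambda>e. if e \<in> S i then {b} else UNIV))"
      by simp
    also have "\<dots> = (\<Prod>e\<in>E. if e \<in> S i then pmf q b else 1)"
      unfolding P_def measure_Pi_pmf_Pi[OF E]
      by (intro prod.cong) (auto simp: measure_pmf_single)
    also have "\<dots> = (\<Prod>e\<in>E \<inter> S i. pmf q b)"
      using E by (simp only: prod.inter_restrict)
    also have "\<dots> = pmf q b ^ k"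
      using S(1,2)[OF i] by (simp add: Int_absorb1)
    finally show ?thesis .
  qed
  then have mean: "(\<Sum>i\<in>I. measure_pmf.expectation P (X i)) = card I * pmf q b ^ k"
    by simp
  have count: "(\<Sum>i\<in>I. X i \<omega>) = card {i \<in> I. \<forall>e\<in>S i. \<omega> e = b}" for \<omega>
    using I by (simp add: X_eq sum.If_cases Int_def)
  have pos: "real (card I) > 0"
    using I by (simp add: card_gt_0_iff)
  have "measure_pmf.prob P {\<omega>. (\<Sum>i\<in>I. X i \<omega>) \<ge> card I * pmf q b ^ k + \<epsilon> * card I}
      \<le> exp (- 2 * (\<epsilon> * card I)\<^sup>2 / card I)"
    using Hoeffding_ineq_ge[of "\<epsilon> * card I"] \<epsilon> pos by (simp add: mean)
  also have "- 2 * (\<epsilon> * card I)\<^sup>2 / card I = - 2 * \<epsilon>\<^sup>2 * card I"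
    using pos by (simp add: power2_eq_square field_simps)
  finally show ?thesis
    unfolding count P_def by (simp add: algebra_simps)
qed

section \<open>Quasirandom tripartite graphs\<close>

text \<open>The classes are consecutive intervals, so that the class of a vertex \<open>w\<close> is \<open>w div m\<close>.\<close>

definition vpart :: "nat \<Rightarrow> nat \<Rightarrow> nat set" where
  "vpart m j = {j * m..<(j + 1) * m}"

text \<open>
  The exponent \<open>card {x, y}\<close> treats degrees, where \<open>x = y\<close>, and codegrees together.
\<close>

definition quasirandom_tripartite :: "nat \<Rightarrow> real \<Rightarrow> real \<Rightarrow> nat set set \<Rightarrow> bool" where
  "quasirandom_tripartite m p \<epsilon> B \<longleftrightarrow> (\<forall>x<3 * m. \<forall>y<3 * m. \<forall>j<3.
     x div m \<noteq> j \<longrightarrow> y div m \<noteq> j \<longrightarrow>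
       real (card {w \<in> vpart m j. {x, w} \<in> B \<and> {y, w} \<in> B}) < (p ^ card {x, y} + \<epsilon>) * m \<and>
       real (card {w \<in> vpart m j. {x, w} \<notin> B \<and> {y, w} \<notin> B}) < ((1 - p) ^ card {x, y} + \<epsilon>) * m)"

lemma card_vpart [simp]: "card (vpart m j) = m"
  by (simp add: vpart_def)

lemma finite_vpart [simp]: "finite (vpart m j)"
  by (simp add: vpart_def)

lemma vpart_div: "w \<in> vpart m j \<Longrightarrow> w div m = j"
  by (auto simp: vpart_def intro!: div_nat_eqI simp: mult.commute)

lemma vpart_subset: "j < 3 \<Longrightarrow> vpart m j \<subseteq> {..<3 * m}"
proof -
  assume "j < 3"
  then have "(j + 1) * m \<le> 3 * m" by (intro mult_right_mono) auto
  then show "vpart m j \<subseteq> {..<3 * m}" unfolding vpart_def by (metis ivl_subset lessThan_atLeast0 zero_le)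
qed

text \<open>
  Let every set of vertices belong to \<open>B\<close> independently with probability \<open>p\<close>. Each of the
  \<open>54 m\<^sup>2\<close> conditions, indexed by \<open>x\<close>, \<open>y\<close>, a class and membership or its negation, fails with
  probability at most \<open>exp (- 2 \<epsilon>\<^sup>2 m)\<close>.
\<close>

lemma quasirandom_tripartite_exists:
  fixes p \<epsilon> :: real
  assumes p: "0 \<le> p" "p \<le> 1" and \<epsilon>: "\<epsilon> > 0"
  shows "\<forall>\<^sub>F m in sequentially. \<exists>B. quasirandom_tripartite m p \<epsilon> B"
proof -
  have "((\<lambda>m. 54 * real m ^ 2 * exp (- 2 * \<epsilon>\<^sup>2 * real m)) \<longlongrightarrow> 0) sequentially"
    using \<epsilon> by real_asymp
  then have "\<forall>\<^sub>F m in sequentially. 54 * real m ^ 2 * exp (- 2 * \<epsilon>\<^sup>2 * real m) < 1"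
    by (rule order_tendstoD) simp
  then show ?thesis
    using eventually_gt_at_top[of 0]
  proof eventually_elim
    case (elim m)
    define E where "E = Pow {..<3 * m}"
    define P where "P = Pi_pmf E False (\<lambda>_. bernoulli_pmf p)"
    define T :: "(nat \<times> nat \<times> nat \<times> bool) set"
      where "T = {..<3 * m} \<times> {..<3 * m} \<times> {..<3} \<times> UNIV"
    define bad where "bad = (\<lambda>(x, y, j, b). {\<omega>. x div m \<noteq> j \<and> y div m \<noteq> j \<and>
      real (card {w \<in> vpart m j. \<forall>e\<in>{{x, w}, {y, w}}. \<omega> e = b})
        \<ge> (pmf (bernoulli_pmf p) b ^ card {x, y} + \<epsilon>) * m})"
    have "measure_pmf.prob P (bad t) \<le> exp (- 2 * \<epsilon>\<^sup>2 * m)" if t: "t \<in> T" for t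
    proof -
      obtain x y j b where t_eq: "t = (x, y, j, b)" by (cases t)
      show ?thesis
      proof (cases "x div m \<noteq> j \<and> y div m \<noteq> j")
        case True
        have ne: "x \<noteq> w" "y \<noteq> w" if "w \<in> vpart m j" for w
          using vpart_div[OF that] True by auto
        have "measure_pmf.prob P {\<omega>. real (card {w \<in> vpart m j. \<forall>e\<in>{{x, w}, {y, w}}. \<omega> e = b})
            \<ge> (pmf (bernoulli_pmf p) b ^ card {x, y} + \<epsilon>) * card (vpart m j)}
          \<le> exp (- 2 * \<epsilon>\<^sup>2 * card (vpart m j))"
          unfolding P_def
        proof (rule many_constant_blocks_unlikely)
          show "finite E" "finite (vpart m j)" "\<epsilon> \<ge> 0"
            using \<epsilon> by (simp_all add: E_def)
          show "vpart m j \<noteq> {}"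
            using elim(2) card_vpart[of m j] by (metis card.empty less_irrefl)
          show "{{x, w}, {y, w}} \<subseteq> E" if "w \<in> vpart m j" for w
            using t that vpart_subset[of j m] by (auto simp: E_def t_eq T_def)
          show "card {{x, w}, {y, w}} = card {x, y}" if "w \<in> vpart m j" for w
            using ne[OF that] by (auto simp: card_insert_if doubleton_eq_iff)
          show "disjoint_family_on (\<lambda>w. {{x, w}, {y, w}}) (vpart m j)"
            using ne by (auto simp: disjoint_family_on_def doubleton_eq_iff)
        qed
        then show ?thesis
          using True by (simp add: bad_def t_eq)
      qed (auto simp: bad_def t_eq)
    qed
    then have "(\<Sum>t\<in>T. measure_pmf.prob P (bad t)) \<le> card T * exp (- 2 * \<epsilon>\<^sup>2 * m)"
      by (rule sum_bounded_above)
    also have "real (card T) = 54 * real m ^ 2"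
      by (simp add: T_def power2_eq_square)
    finally have "(\<Sum>t\<in>T. measure_pmf.prob P (bad t)) < 1"
      using elim(1) by linarith
    moreover have "finite T"
      by (simp add: T_def)
    then have "measure_pmf.prob P (\<Union>t\<in>T. bad t) \<le> (\<Sum>t\<in>T. measure_pmf.prob P (bad t))"
      by (intro measure_pmf.finite_measure_subadditive_finite) auto
    ultimately have "measure_pmf.prob P (\<Union>t\<in>T. bad t) < 1"
      by linarith
    then have "(\<Union>t\<in>T. bad t) \<noteq> UNIV"
      using measure_pmf.prob_space[of P] by auto
    then obtain \<omega> where "\<omega> \<notin> (\<Union>t\<in>T. bad t)"
      by blast
    then have good: "\<omega> \<notin> bad (x, y, j, b)" if "x < 3 * m" "y < 3 * m" "j < 3" for x y j b
      using that by (auto simp: T_def)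
    have "quasirandom_tripartite m p \<epsilon> (Collect \<omega>)"
      unfolding quasirandom_tripartite_def
    proof (intro allI impI)
      fix x y j
      assume *: "x < 3 * m" "y < 3 * m" "j < 3" "x div m \<noteq> j" "y div m \<noteq> j"
      show "real (card {w \<in> vpart m j. {x, w} \<in> Collect \<omega> \<and> {y, w} \<in> Collect \<omega>})
            < (p ^ card {x, y} + \<epsilon>) * m \<and>
          real (card {w \<in> vpart m j. {x, w} \<notin> Collect \<omega> \<and> {y, w} \<notin> Collect \<omega>})
            < ((1 - p) ^ card {x, y} + \<epsilon>) * m"
        using good[OF *(1-3), of True] good[OF *(1-3), of False] *(4,5) p
        by (simp add: bad_def not_le)
    qed
    then show ?case ..
  qed
qed

section \<open>Books and Ramsey numbers\<close>

lemma book_copy_common_neighbours: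
  assumes "has_copy (V, E) (book a)" and V: "finite V"
  obtains x y where "x \<in> V" "y \<in> V" "{x, y} \<in> E"
    "a \<le> card {w \<in> V. {x, w} \<in> E \<and> {y, w} \<in> E}"
proof -
  obtain f where "inj_on f (fst (book a))" "f ` fst (book a) \<subseteq> V"
    and f3: "\<And>e. e \<in> snd (book a) \<Longrightarrow> f ` e \<in> E"
    using assms(1) unfolding has_copy_def by auto
  then have f: "inj_on f {..<a + 2}" "f ` {..<a + 2} \<subseteq> V"
    by (simp_all add: book_def)
  have spine: "{f 0, f 1} \<in> E"
    using f3[of "{0, 1}"] by (simp add: book_def)
  have "{0, k} \<in> snd (book a)" "{1, k} \<in> snd (book a)" if "k \<in> {2..<a + 2}" for k
    using that by (auto simp: book_def)
  from this[THEN f3] have "{f 0, f k} \<in> E" "{f 1, f k} \<in> E" if "k \<in> {2..<a + 2}" for k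
    using that by simp_all
  then have "f ` {2..<a + 2} \<subseteq> {w \<in> V. {f 0, w} \<in> E \<and> {f 1, w} \<in> E}"
    using f(2) by auto
  then have "card (f ` {2..<a + 2}) \<le> card {w \<in> V. {f 0, w} \<in> E \<and> {f 1, w} \<in> E}"
    using V by (intro card_mono) auto
  moreover have "card (f ` {2..<a + 2}) = a"
    using card_image[OF inj_on_subset[OF f(1), of "{2..<a + 2}"]] by (simp add: subset_iff)
  ultimately show thesis
    using that[of "f 0" "f 1"] spine f(2) by auto
qed

text \<open>A colouring of the larger complete graph restricts to one of the smaller.\<close>

lemma ramsey_arrow_mono:
  assumes "ramsey_arrow M G H" and "M \<le> N"
  shows "ramsey_arrow N G H"
  unfolding ramsey_arrow_def
proof (intro allI impI)
  fix R assume "R \<subseteq> [{..<N}]\<^bsup>2\<^esup>"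
  define R' where "R' = R \<inter> [{..<M}]\<^bsup>2\<^esup>"
  have sub: "[{..<M}]\<^bsup>2\<^esup> \<subseteq> [{..<N}]\<^bsup>2\<^esup>"
    using assms(2) by (intro nsets_mono) auto
  have mono: "has_copy ({..<N}, E) K" if "has_copy ({..<M}, E') K" "E' \<subseteq> E" for E E' and K :: "'c graph"
    using that assms(2) unfolding has_copy_def by fastforce
  have "has_copy ({..<M}, R') G \<or> has_copy ({..<M}, [{..<M}]\<^bsup>2\<^esup> - R') H"
    using assms(1) by (auto simp: ramsey_arrow_def R'_def)
  then show "has_copy ({..<N}, R) G \<or> has_copy ({..<N}, [{..<N}]\<^bsup>2\<^esup> - R) H"
    using mono[of R' G R] mono[of "[{..<M}]\<^bsup>2\<^esup> - R'" H "[{..<N}]\<^bsup>2\<^esup> - R"] sub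
    by (auto simp: R'_def)
qed

lemma ramsey_number_gt:
  assumes "\<not> ramsey_arrow N G H"
    and "simple_graph G" "finite (fst G)" "simple_graph H" "finite (fst H)"
  shows "N < ramsey_number G H"
proof -
  have "\<exists>N. N > 0 \<and> ramsey_arrow N G H"
    using ramsey_number_exists[OF assms(2-)] by blast
  then have "ramsey_arrow (ramsey_number G H) G H"
    unfolding ramsey_number_def by (rule LeastI2_ex) simp
  then show ?thesis
    using ramsey_arrow_mono[of "ramsey_number G H" G H N] assms(1) by (meson not_le)
qed

section \<open>The colouring\<close>

text \<open>
  Red are the pairs between different classes that are not in \<open>B\<close>. The pages of a red book lie in the
  class avoided by its spine. The pages of a blue book are counted class by class: at most \<open>m\<close>
  in a class that contains the whole spine, about \<open>p m\<close> in a class that contains one end of it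
  (namely neighbours of the other end), and about \<open>p\<^sup>2 m\<close> in a class that contains neither.
\<close>

lemma tripartite_colouring_avoids_books:
  assumes B: "quasirandom_tripartite m p \<epsilon> B" and m: "m > 0"
    and red: "((1 - p)\<^sup>2 + \<epsilon>) * m \<le> a" and blue: "(1 + 2 * p\<^sup>2 + 3 * \<epsilon>) * m \<le> b"
    and \<epsilon>: "\<epsilon> \<ge> 0"
  shows "\<not> ramsey_arrow (3 * m) (book a) (book b)"
proof
  let ?V = "{..<3 * m}"
  define R where "R = {{x, y} |x y. x < 3 * m \<and> y < 3 * m \<and> x div m \<noteq> y div m \<and> {x, y} \<notin> B}"
  have R_iff: "{x, y} \<in> R \<longleftrightarrow> x < 3 * m \<and> y < 3 * m \<and> x div m \<noteq> y div m \<and> {x, y} \<notin> B" for x y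
    unfolding R_def by (auto simp: doubleton_eq_iff insert_commute)
  have R_sub: "R \<subseteq> [?V]\<^bsup>2\<^esup>"
    unfolding R_def by (auto simp: doubleton_in_nsets_2)
  define C where "C = [?V]\<^bsup>2\<^esup> - R"
  have C_iff: "{x, y} \<in> C \<longleftrightarrow> x < 3 * m \<and> y < 3 * m \<and> x \<noteq> y \<and> (x div m = y div m \<or> {x, y} \<in> B)" for x y
    by (auto simp: C_def R_iff doubleton_in_nsets_2)
  have in_vpart: "w \<in> vpart m (w div m)" for w
    using m dividend_less_times_div[of m w] by (simp add: vpart_def mult.commute[of _ m])
  have div3: "w div m < 3" if "w < 3 * m" for w
    using that by (simp add: less_mult_imp_div_less)
  have three: "{..<3} = {i, j, k}" if "i < 3" "j < 3" "k < 3" "i \<noteq> j" "k \<noteq> i" "k \<noteq> j" for i j k :: nat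
    using that by auto
  have third: "\<exists>k<3. k \<noteq> i \<and> k \<noteq> j" for i j :: nat
  proof -
    have "\<not> {0, 1, 2} \<subseteq> {i, j}" by auto
    then obtain k where "k \<in> {0, 1, 2}" "k \<notin> {i, j}" by blast
    then show ?thesis by (intro exI[of _ k]) auto
  qed
  assume "ramsey_arrow (3 * m) (book a) (book b)"
  then consider "has_copy (?V, R) (book a)" | "has_copy (?V, C) (book b)"
    using R_sub unfolding ramsey_arrow_def C_def by blast
  then show False
  proof cases
    case 1
    then obtain x y where xy: "{x, y} \<in> R" "a \<le> card {w \<in> ?V. {x, w} \<in> R \<and> {y, w} \<in> R}"
      by (rule book_copy_common_neighbours) simp_all
    then have ij: "x < 3 * m" "y < 3 * m" "x div m \<noteq> y div m" "x div m < 3" "y div m < 3"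
      using div3 by (auto simp: R_iff)
    obtain k where k: "k < 3" "k \<noteq> x div m" "k \<noteq> y div m"
      using third by blast
    have "{w \<in> ?V. {x, w} \<in> R \<and> {y, w} \<in> R} \<subseteq> {w \<in> vpart m k. {x, w} \<notin> B \<and> {y, w} \<notin> B}"
    proof
      fix w assume "w \<in> {w \<in> ?V. {x, w} \<in> R \<and> {y, w} \<in> R}"
      then have w: "w < 3 * m" "{x, w} \<in> R" "{y, w} \<in> R"
        by simp_all
      have "w div m \<in> {x div m, y div m, k}"
        unfolding three[OF ij(4,5) k(1) ij(3) k(2,3), symmetric] using div3[OF w(1)] by simp
      then have "w div m = k"
        using w(2,3) unfolding R_iff by auto
      then show "w \<in> {w \<in> vpart m k. {x, w} \<notin> B \<and> {y, w} \<notin> B}"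
        using w in_vpart[of w] by (simp add: R_iff)
    qed
    then have "card {w \<in> ?V. {x, w} \<in> R \<and> {y, w} \<in> R}
        \<le> card {w \<in> vpart m k. {x, w} \<notin> B \<and> {y, w} \<notin> B}"
      by (intro card_mono) simp_all
    then have "a \<le> card {w \<in> vpart m k. {x, w} \<notin> B \<and> {y, w} \<notin> B}"
      using xy(2) by linarith
    moreover have "real (card {w \<in> vpart m k. {x, w} \<notin> B \<and> {y, w} \<notin> B}) < ((1 - p)\<^sup>2 + \<epsilon>) * m"
    proof -
      have "card {x, y} = 2" using ij(3) by (auto simp: card_insert_if)
      moreover have "real (card {w \<in> vpart m k. {x, w} \<notin> B \<and> {y, w} \<notin> B})
          < ((1 - p) ^ card {x, y} + \<epsilon>) * m"
        using B[unfolded quasirandom_tripartite_def, rule_format, OF ij(1,2) k(1)] k(2,3) by auto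
      ultimately show ?thesis by simp
    qed
    ultimately show False using red by linarith
  next
    case 2
    then obtain x y where xy: "{x, y} \<in> C" "b \<le> card {w \<in> ?V. {x, w} \<in> C \<and> {y, w} \<in> C}"
      by (rule book_copy_common_neighbours) simp_all
    then have ij: "x < 3 * m" "y < 3 * m" "x \<noteq> y" "x div m < 3" "y div m < 3"
      using div3 by (auto simp: C_iff)
    define N where "N j = {w \<in> vpart m j. {x, w} \<in> C \<and> {y, w} \<in> C}" for j
    have finN [simp]: "finite (N j)" for j
      by (simp add: N_def)
    have N_le: "real (card (N j)) \<le> m" for j
      using card_mono[of "vpart m j" "N j"] by (auto simp: N_def)
    have N_le1: "real (card (N j)) \<le> (p + \<epsilon>) * m"
      if "j < 3" "z \<in> {x, y}" "z div m \<noteq> j" for j z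
    proof -
      have "N j \<subseteq> {w \<in> vpart m j. {z, w} \<in> B \<and> {z, w} \<in> B}"
        using that by (auto simp: N_def C_iff dest: vpart_div)
      then have "real (card (N j)) \<le> real (card {w \<in> vpart m j. {z, w} \<in> B \<and> {z, w} \<in> B})"
        by (intro of_nat_mono card_mono) simp_all
      also have "\<dots> < (p ^ card {z, z} + \<epsilon>) * m"
        using B[unfolded quasirandom_tripartite_def, rule_format, of z z j] that ij(1,2) by auto
      finally show ?thesis by simp
    qed
    have N_less2: "real (card (N j)) < (p\<^sup>2 + \<epsilon>) * m"
      if "j < 3" "x div m \<noteq> j" "y div m \<noteq> j" for j
    proof -
      have "N j \<subseteq> {w \<in> vpart m j. {x, w} \<in> B \<and> {y, w} \<in> B}"
        using that by (auto simp: N_def C_iff dest: vpart_div)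
      then have "real (card (N j)) \<le> real (card {w \<in> vpart m j. {x, w} \<in> B \<and> {y, w} \<in> B})"
        by (intro of_nat_mono card_mono) simp_all
      also have "\<dots> < (p ^ card {x, y} + \<epsilon>) * m"
        using B[unfolded quasirandom_tripartite_def, rule_format, of x y j] that ij(1,2) by auto
      finally show ?thesis using ij(3) by (simp add: power2_eq_square)
    qed
    have "{w \<in> ?V. {x, w} \<in> C \<and> {y, w} \<in> C} \<subseteq> (\<Union>j<3. N j)"
      using in_vpart div3 by (auto simp: N_def)
    then have "card {w \<in> ?V. {x, w} \<in> C \<and> {y, w} \<in> C} \<le> card (\<Union>j<3. N j)"
      by (intro card_mono) auto
    also have "\<dots> \<le> (\<Sum>j<3. card (N j))"
      by (rule card_UN_le) simp
    finally have b_le: "real b \<le> (\<Sum>j<3. real (card (N j)))"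
      using xy(2) by (simp flip: of_nat_sum)
    show False
    proof (cases "x div m = y div m")
      case True
      obtain j where j: "j < 3" "j \<noteq> x div m"
        using third by blast
      obtain k where k: "k < 3" "k \<noteq> x div m" "k \<noteq> j"
        using third by blast
      have "real b \<le> real (card (N (x div m))) + real (card (N j)) + real (card (N k))"
        using b_le j k by (simp add: three[OF ij(4) j(1) k(1) j(2)[symmetric] k(2,3)])
      also have "\<dots> < m + (p\<^sup>2 + \<epsilon>) * m + (p\<^sup>2 + \<epsilon>) * m"
        using j k True by (intro add_le_less_mono add_mono N_le less_imp_le N_less2) auto
      also have "\<dots> \<le> (1 + 2 * p\<^sup>2 + 3 * \<epsilon>) * m"
        using \<epsilon> by (simp add: algebra_simps)
      finally show False using blue by linarith
    next
      case False
      obtain k where k: "k < 3" "k \<noteq> x div m" "k \<noteq> y div m"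
        using third by blast
      have "real b \<le> real (card (N (x div m))) + real (card (N (y div m))) + real (card (N k))"
        using b_le False k by (simp add: three[OF ij(4,5) k(1) False k(2,3)])
      also have "\<dots> < (p + \<epsilon>) * m + (p + \<epsilon>) * m + (p\<^sup>2 + \<epsilon>) * m"
        using False ij k by (intro add_le_less_mono add_mono N_le1[of _ y] N_le1[of _ x] N_less2) auto
      finally have "real b < (2 * p + p\<^sup>2 + 3 * \<epsilon>) * m"
        by (simp add: algebra_simps)
      also have "\<dots> \<le> (1 + 2 * p\<^sup>2 + 3 * \<epsilon>) * m"
        using zero_le_power2[of "1 - p"]
        by (intro mult_right_mono) (simp_all add: power2_eq_square algebra_simps)
      finally show False using blue by linarith
    qed
  qed
qed

section \<open>The numerical inequality\<close>

text \<open>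
  The equation for \<open>p\<close> is the quadratic \<open>(1 - 2 \<alpha>) p\<^sup>2 - 2 p + 1 - \<alpha> = 0\<close>, whose reduced
  discriminant is \<open>\<alpha> (3 - 2 \<alpha>)\<close>.
\<close>

lemma density_bounds:
  fixes \<alpha> p :: real
  assumes \<alpha>: "0 < \<alpha>" "\<alpha> < 1 / 2"
    and p: "p = (1 - sqrt (\<alpha> * (3 - 2 * \<alpha>))) / (1 - 2 * \<alpha>)"
  shows "0 < p" "p < 1" "(1 - p)\<^sup>2 = \<alpha> * (1 + 2 * p\<^sup>2)"
proof -
  define s where "s = sqrt (\<alpha> * (3 - 2 * \<alpha>))"
  have s2: "s\<^sup>2 = \<alpha> * (3 - 2 * \<alpha>)"
    using \<alpha> by (simp add: s_def)
  have "0 < (1 - \<alpha>) * (1 - 2 * \<alpha>)"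
    using \<alpha> by (intro mult_pos_pos) auto
  then have "\<alpha> * (3 - 2 * \<alpha>) < 1"
    by (simp add: algebra_simps)
  then have s1: "s < 1"
    by (simp add: s_def)
  have "0 < \<alpha> * (1 - 2 * \<alpha>)"
    using \<alpha> by (intro mult_pos_pos) auto
  then have "(2 * \<alpha>)\<^sup>2 < s\<^sup>2"
    unfolding s2 by (simp add: power2_eq_square algebra_simps)
  then have s0: "2 * \<alpha> < s"
    by (rule power2_less_imp_less) (use \<alpha> in \<open>simp add: s_def\<close>)
  show "0 < p" "p < 1"
    using \<alpha> s0 s1 by (simp_all add: p flip: s_def)
  have "(1 - 2 * \<alpha>) * p = 1 - s"
    using \<alpha> by (simp add: p s_def)
  then have "(1 - (1 - 2 * \<alpha>) * p)\<^sup>2 = \<alpha> * (3 - 2 * \<alpha>)"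
    by (simp add: s2)
  then have "(1 - 2 * \<alpha>) * ((1 - p)\<^sup>2 - \<alpha> * (1 + 2 * p\<^sup>2)) = 0"
    by algebra
  then show "(1 - p)\<^sup>2 = \<alpha> * (1 + 2 * p\<^sup>2)"
    using \<alpha> by simp
qed

text \<open>
  Monotonicity of \<open>(1 - p)\<^sup>2 / (1 + 2 p\<^sup>2)\<close>, cross-multiplied: the bound on \<open>\<alpha>\<close> is the value
  at \<open>p = 2 sqrt 3 - 3\<close>.
\<close>

lemma density_gt:
  fixes \<alpha> p :: real
  assumes p: "0 < p" "p < 1" and eq: "(1 - p)\<^sup>2 = \<alpha> * (1 + 2 * p\<^sup>2)"
    and \<alpha>: "\<alpha> < (52 - 16 * sqrt 3) / 121"
  shows "2 * sqrt 3 - 3 < p"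
proof (rule ccontr)
  define r where "r = 2 * sqrt 3 - 3"
  have "sqrt 3 \<le> 2"
    by (rule real_le_lsqrt) auto
  then have r1: "r \<le> 1"
    by (simp add: r_def)
  assume "\<not> 2 * sqrt 3 - 3 < p"
  then have pr: "p \<le> r" by (simp add: r_def)
  have "(1 - r)\<^sup>2 * (1 + 2 * p\<^sup>2) \<le> (1 - p)\<^sup>2 * (1 + 2 * r\<^sup>2)"
    using p pr r1 by (intro mult_mono power_mono add_left_mono mult_left_mono) auto
  also have "\<dots> = \<alpha> * (1 + 2 * r\<^sup>2) * (1 + 2 * p\<^sup>2)"
    by (simp add: eq)
  finally have "(1 - r)\<^sup>2 \<le> \<alpha> * (1 + 2 * r\<^sup>2)"
    using zero_le_power2[of p] by (subst (asm) mult_le_cancel_right) linarith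
  moreover have "(1 - r)\<^sup>2 = (52 - 16 * sqrt 3) / 121 * (1 + 2 * r\<^sup>2)"
    by (simp add: r_def power2_eq_square algebra_simps)
  moreover have "0 < 1 + 2 * r\<^sup>2"
    by (simp add: add_pos_nonneg)
  ultimately show False
    using \<alpha> by (simp add: mult_le_cancel_right)
qed

text \<open>
  The quantity \<open>(sqrt \<alpha> + 1)\<^sup>2\<close> is the constant obtained from a random colouring in which all
  edges have the same probability of being red, chosen optimally; hence the name.
\<close>

lemma tripartite_beats_quasirandom:
  fixes \<alpha> p :: real
  assumes \<alpha>: "0 < \<alpha>" and p: "2 * sqrt 3 - 3 < p" "p < 1" and eq: "(1 - p)\<^sup>2 = \<alpha> * (1 + 2 * p\<^sup>2)"
  shows "(sqrt \<alpha> + 1)\<^sup>2 < 3 / (1 + 2 * p\<^sup>2)"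
proof -
  define t where "t = sqrt (1 + 2 * p\<^sup>2)"
  have pos: "0 < 1 + 2 * p\<^sup>2"
    by (simp add: add_pos_nonneg)
  then have t: "0 < t" "t\<^sup>2 = 1 + 2 * p\<^sup>2"
    by (simp_all add: t_def)
  have "sqrt \<alpha> * t = sqrt ((1 - p)\<^sup>2)"
    by (simp add: t_def eq real_sqrt_mult)
  then have st: "sqrt \<alpha> * t = 1 - p"
    using p by simp
  have "sqrt 3 \<ge> 3 / 2"
    by (rule real_le_rsqrt) (simp add: power2_eq_square)
  have "0 < (1 - p) * (p - (2 * sqrt 3 - 3))"
    using p by (intro mult_pos_pos) auto
  then have "t\<^sup>2 < (sqrt 3 - 1 + p)\<^sup>2"
    unfolding t by (simp add: power2_eq_square algebra_simps)
  then have "t < sqrt 3 - 1 + p"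
    by (rule power2_less_imp_less) (use p \<open>sqrt 3 \<ge> 3 / 2\<close> in linarith)
  then have "(sqrt \<alpha> + 1) * t < sqrt 3"
    using st by (simp add: algebra_simps)
  then have "((sqrt \<alpha> + 1) * t)\<^sup>2 < (sqrt 3)\<^sup>2"
    using t(1) \<alpha> by (intro power_strict_mono) auto
  then show ?thesis
    unfolding power_mult_distrib t(2) using pos by (simp add: pos_less_divide_eq)
qed

section \<open>The lower bound\<close>

theorem mainTheorem4:
  fixes \<alpha> p :: real
  assumes "1 / 6 \<le> \<alpha>" and "\<alpha> < (52 - 16 * sqrt 3) / 121"
    and "p = (1 - sqrt (\<alpha> * (3 - 2 * \<alpha>))) / (1 - 2 * \<alpha>)"
  shows "3 / (1 + 2 * p\<^sup>2) > (sqrt \<alpha> + 1)\<^sup>2 \<and>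
    (\<exists>\<beta>>(sqrt \<alpha> + 1)\<^sup>2. \<forall>\<^sub>F n in sequentially.
       real (ramsey_number (book (nat \<lceil>\<alpha> * real n\<rceil>)) (book n)) \<ge> \<beta> * real n)"
proof -
  have "sqrt 3 \<ge> 3 / 2"
    by (rule real_le_rsqrt) (simp add: power2_eq_square)
  then have "(52 - 16 * sqrt 3) / 121 \<le> (52 - 16 * (3 / 2)) / 121"
    by (intro divide_right_mono diff_left_mono mult_left_mono) simp_all
  also have "\<dots> < (1 / 2 :: real)"
    by simp
  finally have "\<alpha> < 1 / 2"
    using assms(2) by (rule order_less_trans[rotated])
  with assms(1) have \<alpha>: "0 < \<alpha>" "\<alpha> < 1 / 2"
    by simp_all
  note p = density_bounds[OF \<alpha> assms(3)]
  define K where "K = 1 + 2 * p\<^sup>2"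
  have K: "K > 0"
    by (simp add: K_def add_pos_nonneg)
  have ineq: "(sqrt \<alpha> + 1)\<^sup>2 < 3 / K"
    unfolding K_def using tripartite_beats_quasirandom[OF \<alpha>(1) density_gt[OF p assms(2)] p(2,3)] .
  then obtain \<beta> where \<beta>: "(sqrt \<alpha> + 1)\<^sup>2 < \<beta>" "\<beta> < 3 / K"
    using dense by blast
  have "0 \<le> (sqrt \<alpha> + 1)\<^sup>2" by simp
  then have \<beta>0: "0 < \<beta>" using \<beta>(1) by linarith
  define \<gamma> where "\<gamma> = \<beta> / 3"
  have \<gamma>: "0 < \<gamma>" "K * \<gamma> < 1"
    using \<beta>0 \<beta>(2) K by (simp_all add: \<gamma>_def field_simps)
  \<comment> \<open>The blue condition has slack \<open>1 - K * \<gamma>\<close> and the red one \<open>\<alpha> * (1 - K * \<gamma>)\<close>, which is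
    less. This choice makes \<open>\<epsilon> * \<gamma>\<close> a sixth of the red slack, so that even \<open>3 * \<epsilon> * \<gamma>\<close> fits the blue one.\<close>
  define \<epsilon> where "\<epsilon> = \<alpha> * (1 - K * \<gamma>) / (6 * \<gamma>)"
  have \<epsilon>: "\<epsilon> > 0"
    using \<gamma> \<alpha> by (simp add: \<epsilon>_def)
  have blue: "(K + 3 * \<epsilon>) * \<gamma> < 1"
  proof -
    have "\<epsilon> * \<gamma> = \<alpha> * (1 - K * \<gamma>) / 6"
      using \<gamma> by (simp add: \<epsilon>_def)
    moreover have "\<alpha> * (1 - K * \<gamma>) < 1 * (1 - K * \<gamma>)"
      using \<alpha> \<gamma> by (intro mult_strict_right_mono) auto
    ultimately show ?thesis
      using \<gamma> by (simp add: algebra_simps)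
  qed
  have red: "(\<alpha> * K + \<epsilon>) * \<gamma> < \<alpha>"
  proof -
    have "\<epsilon> * \<gamma> = \<alpha> * (1 - K * \<gamma>) / 6"
      using \<gamma> by (simp add: \<epsilon>_def)
    moreover have "0 < \<alpha> * (1 - K * \<gamma>)"
      using \<alpha> \<gamma> by simp
    ultimately show ?thesis
      by (simp add: algebra_simps)
  qed
  have rounding: "\<forall>\<^sub>F n in sequentially. c * real (nat \<lceil>\<gamma> * real n\<rceil>) \<le> d * real n"
    if "c > 0" "c * \<gamma> < d" for c d
  proof -
    have "\<forall>\<^sub>F n in sequentially. c * (\<gamma> * real n + 1) \<le> d * real n"
      using that by real_asymp
    then show ?thesis
    proof eventually_elim
      case (elim n)
      have "real (nat \<lceil>\<gamma> * real n\<rceil>) \<le> \<gamma> * real n + 1"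
        using \<gamma>(1) by (simp add: of_nat_nat)
      then have "c * real (nat \<lceil>\<gamma> * real n\<rceil>) \<le> c * (\<gamma> * real n + 1)"
        using that(1) by (intro mult_left_mono) auto
      then show ?case using elim by linarith
    qed
  qed
  have lim: "filterlim (\<lambda>n. nat \<lceil>\<gamma> * real n\<rceil>) at_top sequentially"
    using \<gamma>(1) by real_asymp
  have "\<forall>\<^sub>F n in sequentially. \<exists>B. quasirandom_tripartite (nat \<lceil>\<gamma> * real n\<rceil>) p \<epsilon> B"
    using quasirandom_tripartite_exists[of p \<epsilon>] p \<epsilon> by (intro eventually_compose_filterlim[OF _ lim]) auto
  moreover have "\<forall>\<^sub>F n in sequentially. (\<alpha> * K + \<epsilon>) * real (nat \<lceil>\<gamma> * real n\<rceil>) \<le> \<alpha> * real n"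
    using \<alpha> K \<epsilon> red by (intro rounding) (auto intro: add_pos_pos)
  moreover have "\<forall>\<^sub>F n in sequentially. (K + 3 * \<epsilon>) * real (nat \<lceil>\<gamma> * real n\<rceil>) \<le> 1 * real n"
    using K \<epsilon> blue by (intro rounding) auto
  ultimately have "\<forall>\<^sub>F n in sequentially.
      real (ramsey_number (book (nat \<lceil>\<alpha> * real n\<rceil>)) (book n)) \<ge> \<beta> * real n"
    using eventually_gt_at_top[of 0]
  proof eventually_elim
    case (elim n)
    define m where "m = nat \<lceil>\<gamma> * real n\<rceil>"
    have m: "m > 0"
      using \<gamma>(1) elim(4) by (simp add: m_def)
    obtain B where B: "quasirandom_tripartite m p \<epsilon> B"
      using elim(1) m_def by auto
    have "((1 - p)\<^sup>2 + \<epsilon>) * m \<le> nat \<lceil>\<alpha> * real n\<rceil>"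
      using elim(2) unfolding m_def p(3) K_def by linarith
    moreover have "(1 + 2 * p\<^sup>2 + 3 * \<epsilon>) * m \<le> n"
      using elim(3) by (simp add: m_def K_def)
    ultimately have "\<not> ramsey_arrow (3 * m) (book (nat \<lceil>\<alpha> * real n\<rceil>)) (book n)"
      using tripartite_colouring_avoids_books[OF B m] \<epsilon> by simp
    then have "3 * m < ramsey_number (book (nat \<lceil>\<alpha> * real n\<rceil>)) (book n)"
      by (intro ramsey_number_gt simple_graph_book finite_book)
    moreover have "\<gamma> * real n \<le> m"
      unfolding m_def by linarith
    ultimately show ?case
      by (simp add: \<gamma>_def)
  qed
  with ineq \<beta>(1) show ?thesis
    unfolding K_def by (intro conjI exI[of _ \<beta>])
qed

end
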